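(* Let $n\ge 1$, $d\ge 1$, $\sigma>0$, and let $p_1,\dots,p_n:[0,\infty)\to\mathbb{R}^d$ be the trajectories of $n$ agents moving according to $$\dot p_i(t)=-\sigma\sum_{j=1}^{n} f\bigl(p_i(t)-p_j(t)\bigr),\qquad f(x)=\begin{cases}\dfrac{x}{\|x\|}, & x\neq 0,\\[1ex] 0,& x=0.\end{cases}$$ Then for any initial constellation the agents converge to the average location of the initial constellation in finite time: there is a finite $T\ge 0$ such that $p_i(t)=\frac1n\sum_{j=1}^n p_j(0)$ for all $i$ and all $t\ge T$.
   Context: This is the continuous-time system $\mathcal{S}_3$ (unlimited visibility, bearing-only sensing): each agent's velocity is $\sigma$ times the sum of the unit vectors pointing from it to all the other agents. $\|\cdot\|$ is the Euclidean norm. The right-hand side is discontinuous where agents coincide; a trajectory is a continuous (absolutely continuous) solution of the differential equation. *)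

theory Defs
  imports "HOL-Analysis.Analysis"
begin

text \<open>
  Absolute continuity in the usual epsilon-delta sense. A division \<open>D\<close> of some subset of \<open>S\<close>
  is exactly a finite family of non-overlapping compact intervals contained in \<open>S\<close>.
\<close>

definition abs_continuous_on :: "real set \<Rightarrow> (real \<Rightarrow> 'a::real_normed_vector) \<Rightarrow> bool" where
  "abs_continuous_on S f \<longleftrightarrow>
     (\<forall>\<epsilon>>0. \<exists>\<delta>>0. \<forall>D. D division_of \<Union>D \<and> \<Union>D \<subseteq> S \<and> (\<Sum>K\<in>D. measure lborel K) < \<delta> \<longrightarrow>
        (\<Sum>K\<in>D. norm (f (Sup K) - f (Inf K))) < \<epsilon>)"

definition unit_dir :: "'a::real_normed_vector \<Rightarrow> 'a" where
  "unit_dir x = (if x \<noteq> 0 then x /\<^sub>R norm x else 0)"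

text \<open>
  Since the right-hand side is discontinuous where agents coincide, a trajectory is a solution in
  the sense of Caratheodory: absolutely continuous on every compact time interval and satisfying
  the differential equation at almost every time. Only times \<open>t \<ge> 0\<close> and agents
  \<open>1, \<dots>, n\<close> are constrained.
\<close>

definition bearing_only_trajectory ::
    "real \<Rightarrow> nat \<Rightarrow> (nat \<Rightarrow> real \<Rightarrow> 'a::real_normed_vector) \<Rightarrow> bool" where
  "bearing_only_trajectory \<sigma> n p \<longleftrightarrow>
     (\<forall>i\<in>{1..n}.
        (\<forall>b\<ge>0. abs_continuous_on {0..b} (p i)) \<and>
        (AE t in lborel. t \<ge> 0 \<longrightarrow>
           (p i has_vector_derivative (- \<sigma> *\<^sub>R (\<Sum>j=1..n. unit_dir (p i t - p j t))))
             (at t within {0..})))"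

end

theory Submission
  imports Defs
begin

text \<open>
  The velocities cancel in pairs, so the centroid \<open>c\<close> is constant. Let \<open>W\<close> be the Euclidean norm of
  the stacked vector of displacements \<open>p i - c\<close>. Symmetrising the double sum gives
  \<open>(W\<^sup>2)' = - \<sigma> * (\<Sum>i. \<Sum>j. norm (p i - p j)) \<le> - \<sigma> * n * (\<Sum>i. norm (p i - c)) \<le> - \<sigma> * n * W\<close>
  at almost every time, that is \<open>W' \<le> - \<sigma> * n / 2\<close> wherever \<open>W > 0\<close>. As \<open>W\<close> is absolutely
  continuous, it vanishes from time \<open>2 * W 0 / (\<sigma> * n)\<close> on.
\<close>

section \<open>Absolute continuity and its transfer between functions\<close>

lemma abs_continuous_onE:
  assumes "abs_continuous_on S f" "\<epsilon> > 0"
  obtains \<delta> where "\<delta> > 0"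
    "\<And>D. \<lbrakk>D division_of \<Union>D; \<Union>D \<subseteq> S; sum (measure lborel) D < \<delta>\<rbrakk>
       \<Longrightarrow> (\<Sum>K\<in>D. norm (f (Sup K) - f (Inf K))) < \<epsilon>"
proof -
  from assms(1)[unfolded abs_continuous_on_def, rule_format, OF assms(2)]
  obtain \<delta> where "\<delta> > 0" "\<forall>D. D division_of \<Union>D \<and> \<Union>D \<subseteq> S \<and>
      sum (measure lborel) D < \<delta> \<longrightarrow> (\<Sum>K\<in>D. norm (f (Sup K) - f (Inf K))) < \<epsilon>"
    by (elim exE conjE)
  with that show thesis by simp
qed

lemma abs_continuous_on_subset:
  assumes "abs_continuous_on S f" "T \<subseteq> S"
  shows "abs_continuous_on T f"
  using assms unfolding abs_continuous_on_def by (meson order_trans)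

text \<open>A division made of one interval \<open>{s..t}\<close> already bounds the increment, with
  a \<open>\<delta>\<close> that does not depend on the point; hence even uniform
  continuity.\<close>

lemma abs_continuous_on_imp_continuous_on:
  assumes "abs_continuous_on {a..b} f"
  shows "continuous_on {a..b} f"
proof (rule uniformly_continuous_imp_continuous, unfold uniformly_continuous_on_def, intro allI impI)
  fix e :: real assume "e > 0"
  then obtain \<delta> where \<delta>: "\<delta> > 0"
    "\<And>D. \<lbrakk>D division_of \<Union>D; \<Union>D \<subseteq> {a..b}; sum (measure lborel) D < \<delta>\<rbrakk>
       \<Longrightarrow> (\<Sum>K\<in>D. norm (f (Sup K) - f (Inf K))) < e"
    using abs_continuous_onE[OF assms] by blast
  have *: "dist (f t) (f s) < e" if "s \<le> t" "s \<in> {a..b}" "t \<in> {a..b}" "t - s < \<delta>" for s t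
  proof -
    have "{{s..t}} division_of \<Union>{{s..t}}"
      using division_of_self[of s t] that by simp
    then show ?thesis
      using \<delta>(2)[of "{{s..t}}"] that by (simp add: dist_norm)
  qed
  show "\<exists>d>0. \<forall>x\<in>{a..b}. \<forall>x'\<in>{a..b}. dist x' x < d \<longrightarrow> dist (f x') (f x) < e"
  proof (intro exI[of _ \<delta>] conjI ballI impI)
    fix x x' assume "x \<in> {a..b}" "x' \<in> {a..b}" "dist x' x < \<delta>"
    then show "dist (f x') (f x) < e"
      using *[of x x'] *[of x' x] by (cases "x \<le> x'") (auto simp: dist_real_def dist_commute)
  qed (rule \<open>\<delta> > 0\<close>)
qed

text \<open>Summing the bound over a division controls the increments of \<open>g\<close> by those
  of finitely many \<open>p i\<close>, and the smallest of their \<open>\<delta> i\<close> serves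
  all of them. This makes both the stacked norm and linear functionals of the centroid absolutely
  continuous.\<close>

lemma abs_continuous_on_dominated:
  fixes p :: "'i \<Rightarrow> real \<Rightarrow> 'a::real_normed_vector" and g :: "real \<Rightarrow> 'b::real_normed_vector"
  assumes I: "finite I" and p: "\<And>i. i \<in> I \<Longrightarrow> abs_continuous_on S (p i)"
    and le: "\<And>s t. \<lbrakk>s \<in> S; t \<in> S\<rbrakk> \<Longrightarrow> norm (g t - g s) \<le> C * (\<Sum>i\<in>I. norm (p i t - p i s))"
  shows "abs_continuous_on S g"
  unfolding abs_continuous_on_def
proof (intro allI impI)
  fix e :: real assume "e > 0"
  \<comment> \<open>The summand 1 keeps \<open>M\<close> positive when \<open>C = 0\<close> or
    \<open>I\<close> is empty, and makes the final estimate strict.\<close>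
  define M where "M = \<bar>C\<bar> * card I + 1"
  have "M > 0" by (simp add: M_def add_nonneg_pos)
  with \<open>e > 0\<close> have "e / M > 0" by simp
  then have "\<exists>\<delta>. i \<in> I \<longrightarrow> \<delta> > 0 \<and> (\<forall>D. D division_of \<Union>D \<and> \<Union>D \<subseteq> S \<and> sum (measure lborel) D < \<delta>
       \<longrightarrow> (\<Sum>K\<in>D. norm (p i (Sup K) - p i (Inf K))) < e / M)" for i
    using abs_continuous_onE[OF p \<open>e / M > 0\<close>, of i] by metis
  then obtain \<delta> where \<delta>: "\<And>i. i \<in> I \<Longrightarrow> \<delta> i > 0"
    "\<And>i D. \<lbrakk>i \<in> I; D division_of \<Union>D; \<Union>D \<subseteq> S; sum (measure lborel) D < \<delta> i\<rbrakk>
       \<Longrightarrow> (\<Sum>K\<in>D. norm (p i (Sup K) - p i (Inf K))) < e / M"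
    by metis
  \<comment> \<open>Inserting 1 gives \<open>Min\<close> a nonempty set even for empty
    \<open>I\<close>.\<close>
  define d where "d = Min (insert 1 (\<delta> ` I))"
  have "d > 0" using \<delta>(1) I by (auto simp: d_def)
  have dle: "d \<le> \<delta> i" if "i \<in> I" for i using that I by (auto simp: d_def intro: Min_le)
  show "\<exists>\<delta>>0. \<forall>D. D division_of \<Union>D \<and> \<Union>D \<subseteq> S \<and> sum (measure lborel) D < \<delta> \<longrightarrow>
      (\<Sum>K\<in>D. norm (g (Sup K) - g (Inf K))) < e"
  proof (intro exI[of _ d] conjI allI impI, rule \<open>d > 0\<close>, elim conjE)
    fix D assume D: "D division_of \<Union>D" "\<Union>D \<subseteq> S" "sum (measure lborel) D < d"
    \<comment> \<open>Members of a division are nonempty compact intervals, so they attain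
      \<open>Sup\<close> and \<open>Inf\<close>, and these lie in \<open>S\<close>.\<close>
    have ends: "Sup K \<in> S" "Inf K \<in> S" if KD: "K \<in> D" for K
    proof -
      obtain u v where K: "K = {u..v}" "K \<noteq> {}"
        using division_ofD(3,4)[OF D(1) KD] by auto
      then have "K \<subseteq> S" "u \<le> v" using D(2) KD by auto
      then show "Sup K \<in> S" "Inf K \<in> S" using K by auto
    qed
    have "(\<Sum>K\<in>D. norm (g (Sup K) - g (Inf K)))
        \<le> (\<Sum>K\<in>D. \<bar>C\<bar> * (\<Sum>i\<in>I. norm (p i (Sup K) - p i (Inf K))))"
    proof (rule sum_mono)
      fix K assume "K \<in> D"
      then have "norm (g (Sup K) - g (Inf K)) \<le> C * (\<Sum>i\<in>I. norm (p i (Sup K) - p i (Inf K)))"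
        using le ends by blast
      also have "\<dots> \<le> \<bar>C\<bar> * (\<Sum>i\<in>I. norm (p i (Sup K) - p i (Inf K)))"
        by (intro mult_right_mono sum_nonneg) auto
      finally show "norm (g (Sup K) - g (Inf K)) \<le> \<dots>" .
    qed
    also have "\<dots> = \<bar>C\<bar> * (\<Sum>i\<in>I. \<Sum>K\<in>D. norm (p i (Sup K) - p i (Inf K)))"
      unfolding sum_distrib_left[symmetric] by (subst sum.swap) (rule refl)
    also have "\<dots> \<le> \<bar>C\<bar> * (\<Sum>i\<in>I. e / M)"
      using D(1,2) less_le_trans[OF D(3) dle]
      by (intro mult_left_mono sum_mono less_imp_le[OF \<delta>(2)]) simp_all
    also have "\<dots> = (\<bar>C\<bar> * card I) * (e / M)" by simp
    also have "\<dots> < M * (e / M)"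
      using \<open>e / M > 0\<close> by (intro mult_strict_right_mono) (auto simp: M_def)
    also have "\<dots> = e" using \<open>M > 0\<close> by simp
    finally show "(\<Sum>K\<in>D. norm (g (Sup K) - g (Inf K))) < e" .
  qed
qed

section \<open>From a derivative bound almost everywhere to a bound on increments\<close>

text \<open>One-sided straddle lemma: as \<open>u\<close> and \<open>v\<close> lie on opposite sides
  of \<open>t\<close>, the linearisation errors \<open>\<epsilon> * (t - u)\<close> and
  \<open>\<epsilon> * (v - t)\<close> add up to exactly \<open>\<epsilon> * (v - u)\<close>.\<close>

lemma real_derivative_straddle_le:
  fixes f :: "real \<Rightarrow> real"
  assumes "(f has_real_derivative D) (at t within S)" "\<epsilon> > 0"
  obtains r where "r > 0"
    "\<And>u v. \<lbrakk>u \<in> S; v \<in> S; u \<le> t; t \<le> v; \<bar>u - t\<bar> < r; \<bar>v - t\<bar> < r\<rbrakk>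
       \<Longrightarrow> f v - f u \<le> (D + \<epsilon>) * (v - u)"
proof -
  from assms obtain r where r: "r > 0"
    "\<And>y. \<lbrakk>y \<in> S; norm (y - t) < r\<rbrakk> \<Longrightarrow> norm (f y - f t - D * (y - t)) \<le> \<epsilon> * norm (y - t)"
    unfolding has_field_derivative_def has_derivative_within_alt by blast
  show thesis
  proof (rule that[OF r(1)])
    fix u v assume uv: "u \<in> S" "v \<in> S" "u \<le> t" "t \<le> v" "\<bar>u - t\<bar> < r" "\<bar>v - t\<bar> < r"
    have "\<bar>f v - f t - D * (v - t)\<bar> \<le> \<epsilon> * (v - t)" "\<bar>f u - f t - D * (u - t)\<bar> \<le> \<epsilon> * (t - u)"
      using r(2)[of v] r(2)[of u] uv by auto
    then show "f v - f u \<le> (D + \<epsilon>) * (v - u)"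
      by (simp add: algebra_simps abs_le_iff)
  qed
qed

text \<open>The intervals do not overlap, so their lengths sum to the measure of their union. The
  sum runs over the intervals, not the tagged pairs, to match the definition of absolute
  continuity.\<close>

lemma tagged_partial_division_sum_content_le:
  assumes p: "p tagged_partial_division_of S" and U: "\<Union>(snd ` p) \<subseteq> U" "U \<in> lmeasurable"
  shows "sum (measure lborel) (snd ` p) \<le> measure lebesgue U"
proof -
  have div: "(snd ` p) division_of \<Union>(snd ` p)"
    using p by (rule partial_division_of_tagged_division)
  have "sum (measure lborel) (snd ` p) = measure lebesgue (\<Union>(snd ` p))"
    using content_division[OF div] sum.cong[OF refl, of "snd ` p" "measure lebesgue" "measure lborel"]
      division_ofD(4)[OF div] by fastforce
  also have "\<dots> \<le> measure lebesgue U"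
    using U lmeasurable_division[OF div] by (intro measure_mono_fmeasurable) (auto intro: fmeasurableD)
  finally show ?thesis .
qed

text \<open>Subdivide along a gauge: at a good tag the derivative controls the increment; the intervals
  with a bad tag lie in an open set of small measure, where absolute continuity applies.\<close>
theorem abs_continuous_on_increment_le:
  fixes f :: "real \<Rightarrow> real"
  assumes "a \<le> b" and ac: "abs_continuous_on {a..b} f" and N: "negligible N"
    and der: "\<And>t. t \<in> {a..b} - N \<Longrightarrow> \<exists>D\<le>L. (f has_real_derivative D) (at t within {a..b})"
  shows "f b - f a \<le> L * (b - a)"
proof -
  \<comment> \<open>The error \<open>e * (b - a)\<close> comes from the good tags and
    \<open>e * (1 + \<bar>L\<bar>)\<close> from the bad ones.\<close>
  have small: "f b - f a - L * (b - a) \<le> e * (b - a + 1 + \<bar>L\<bar>)" if "e > 0" for e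
  proof -
    obtain \<delta> where \<delta>: "\<delta> > 0"
      "\<And>D. \<lbrakk>D division_of \<Union>D; \<Union>D \<subseteq> {a..b}; sum (measure lborel) D < \<delta>\<rbrakk>
         \<Longrightarrow> (\<Sum>K\<in>D. norm (f (Sup K) - f (Inf K))) < e"
      using abs_continuous_onE[OF ac \<open>e > 0\<close>] by blast
    \<comment> \<open>Measure below \<open>\<delta>\<close> lets absolute continuity act inside
      \<open>U\<close>; measure below \<open>e\<close> bounds the contribution of \<open>L\<close>
      times the length there.\<close>
    have "min \<delta> e > 0" using \<delta> that by simp
    then obtain U where U: "open U" "N \<subseteq> U" "(U - N) \<in> lmeasurable"
        "emeasure lebesgue (U - N) < ennreal (min \<delta> e)"
      using sets_lebesgue_outer_open[OF negligible_imp_sets[OF N]] by blast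
    \<comment> \<open>The outer approximation bounds only \<open>U - N\<close>; putting back the
      negligible \<open>N\<close> leaves the measure unchanged.\<close>
    have "U = (U - N) \<union> N" using U(2) by blast
    then have Um: "U \<in> lmeasurable"
      using fmeasurable.Un[OF U(3) negligible_imp_measurable[OF N]] by simp
    have "measure lebesgue U = measure lebesgue (U - N)"
      by (rule measure_negligible_symdiff[OF U(3)]) (auto intro: negligible_subset[OF N])
    also have "\<dots> < min \<delta> e"
      using U(3,4) \<open>min \<delta> e > 0\<close> by (simp add: emeasure_eq_measure2 ennreal_less_iff)
    finally have mU: "measure lebesgue U < min \<delta> e" .
    \<comment> \<open>The gauge: at a bad tag the ball stays in \<open>U\<close>, at a good tag the
      straddle estimate holds. Elsewhere both conditions are vacuous and any radius will do.\<close>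
    have "\<exists>r>0. (t \<in> N \<longrightarrow> ball t r \<subseteq> U) \<and> (t \<in> {a..b} - N \<longrightarrow>
        (\<forall>u v. u \<in> {a..b} \<and> v \<in> {a..b} \<and> u \<le> t \<and> t \<le> v \<and> \<bar>u - t\<bar> < r \<and> \<bar>v - t\<bar> < r
          \<longrightarrow> f v - f u \<le> (L + e) * (v - u)))" for t
    proof (cases "t \<in> N")
      case True
      then show ?thesis using U(1,2) by (auto simp: open_contains_ball)
    next
      case False
      show ?thesis
      proof (cases "t \<in> {a..b}")
        case True
        then obtain D where D: "D \<le> L" "(f has_real_derivative D) (at t within {a..b})"
          using der False by blast
        obtain r where r: "r > 0"
          "\<And>u v. \<lbrakk>u \<in> {a..b}; v \<in> {a..b}; u \<le> t; t \<le> v; \<bar>u - t\<bar> < r; \<bar>v - t\<bar> < r\<rbrakk>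
            \<Longrightarrow> f v - f u \<le> (D + e) * (v - u)"
          using real_derivative_straddle_le[OF D(2) \<open>e > 0\<close>] by blast
        have "(D + e) * (v - u) \<le> (L + e) * (v - u)" if "u \<le> t" "t \<le> v" for u v
          using D(1) that by (intro mult_right_mono) auto
        with r False show ?thesis by (meson order_trans)
      qed (use False in \<open>auto intro: exI[of _ 1]\<close>)
    qed
    then obtain r where r: "\<And>t. r t > 0" "\<And>t. t \<in> N \<Longrightarrow> ball t (r t) \<subseteq> U"
      "\<And>t u v. \<lbrakk>t \<in> {a..b} - N; u \<in> {a..b}; v \<in> {a..b}; u \<le> t; t \<le> v; \<bar>u - t\<bar> < r t; \<bar>v - t\<bar> < r t\<rbrakk>
          \<Longrightarrow> f v - f u \<le> (L + e) * (v - u)"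
      by metis
    obtain p where p: "p tagged_division_of {a..b}" "(\<lambda>t. ball t (r t)) fine p"
      using fine_division_exists_real[OF gauge_ball_dependent] r(1) by metis
    define q where "q = {(t, K) \<in> p. t \<in> N}"
    have "q \<subseteq> p" "finite p" using p by (auto simp: q_def)
    then have q: "q tagged_partial_division_of {a..b}"
      using p(1) unfolding tagged_division_of_def by (auto intro: tagged_partial_division_subset)
    have "K \<subseteq> U" if "(t, K) \<in> q" for t K
      using that fineD[OF p(2), of t K] r(2)[of t] by (auto simp: q_def)
    then have qU: "\<Union>(snd ` q) \<subseteq> U" by fastforce
    have content_q: "sum (measure lborel) (snd ` q) < min \<delta> e"
      using tagged_partial_division_sum_content_le[OF q qU Um] mU by simp
    have qab: "\<Union>(snd ` q) \<subseteq> {a..b}" using tagged_partial_division_ofD(3)[OF q] by fastforce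
    \<comment> \<open>\<open>E\<close> bounds the excess of the increment over \<open>L\<close>
      times the length at a bad tag. It is set to 0 on the empty interval, where \<open>Sup\<close>
      and \<open>Inf\<close> carry no information, so that it vanishes on every interval with empty
      interior.\<close>
    define E where "E K = (if K = {} then 0 else norm (f (Sup K) - f (Inf K)) + \<bar>L\<bar> * measure lborel K)"
      for K
    \<comment> \<open>Distinct tagged pairs can share an interval only if its interior is empty, and
      there \<open>E\<close> is 0; so the sum may pass from pairs to intervals.\<close>
    have "(\<Sum>(t, K)\<in>q. E K) = sum E (snd ` q)"
    proof (rule sum.over_tagged_division_lemma[OF tagged_partial_division_of_Union_self[OF q]])
      fix u v :: real assume "box u v = {}"
      then show "E (cbox u v) = 0"
        by (cases "u = v") (auto simp: E_def)
    qed
    also have "\<dots> = (\<Sum>K\<in>snd ` q. norm (f (Sup K) - f (Inf K)) + \<bar>L\<bar> * measure lborel K)"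
      using tagged_partial_division_ofD(2)[OF q] by (intro sum.cong) (fastforce simp: E_def)+
    also have "\<dots> \<le> e + \<bar>L\<bar> * e"
      unfolding sum.distrib sum_distrib_left[symmetric]
      using \<delta>(2)[OF partial_division_of_tagged_division[OF q] qab] content_q
      by (intro add_mono mult_left_mono) auto
    finally have q_le: "(\<Sum>(t, K)\<in>q. E K) \<le> e + \<bar>L\<bar> * e" .
    have incr: "(f (Sup K) - f (Inf K)) - L * (Sup K - Inf K)
        \<le> e * (Sup K - Inf K) + (if (t, K) \<in> q then E K else 0)" if tK: "(t, K) \<in> p" for t K
    proof -
      obtain u v where K: "K = {u..v}" "t \<in> K" "K \<subseteq> {a..b}" "K \<subseteq> ball t (r t)"
        using tagged_division_ofD(2-4)[OF p(1) tK] fineD[OF p(2) tK] by auto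
      then have uv: "u \<le> t" "t \<le> v" "Sup K = v" "Inf K = u" "measure lborel K = v - u" by auto
      show ?thesis
      proof (cases "t \<in> N")
        case True
        have "- (L * (v - u)) \<le> \<bar>L\<bar> * (v - u)"
          using uv mult_right_mono[of "-L" "\<bar>L\<bar>" "v - u"] by simp
        moreover have "0 \<le> e * (v - u)" using uv \<open>e > 0\<close> by simp
        moreover have "(t, K) \<in> q" using True tK by (simp add: q_def)
        ultimately show ?thesis using K(2) unfolding E_def uv by auto
      next
        case False
        have "u \<in> K" "v \<in> K" using K uv by auto
        then have "u \<in> {a..b}" "v \<in> {a..b}" "t \<in> {a..b}" "\<bar>u - t\<bar> < r t" "\<bar>v - t\<bar> < r t"
          using K(2) subsetD[OF K(3)] subsetD[OF K(4)] by (auto simp: dist_real_def abs_minus_commute[of _ t])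
        then have "f v - f u \<le> (L + e) * (v - u)"
          using False uv by (intro r(3)[of t]) auto
        moreover have "(t, K) \<notin> q" using False by (simp add: q_def)
        ultimately show ?thesis by (simp add: uv algebra_simps)
      qed
    qed
    have len: "(\<Sum>(t, K)\<in>p. Sup K - Inf K) = b - a"
      using additive_tagged_division_1[OF \<open>a \<le> b\<close> p(1), of "\<lambda>x. x"] .
    \<comment> \<open>The increments and the lengths telescope over the tagged division, which
      reduces the claim to the termwise bound \<open>incr\<close>.\<close>
    have "f b - f a - L * (b - a)
        = (\<Sum>(t, K)\<in>p. f (Sup K) - f (Inf K)) - L * (\<Sum>(t, K)\<in>p. Sup K - Inf K)"
      using additive_tagged_division_1[OF \<open>a \<le> b\<close> p(1), of f] len by simp
    also have "\<dots> = (\<Sum>(t, K)\<in>p. (f (Sup K) - f (Inf K)) - L * (Sup K - Inf K))"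
      unfolding sum_distrib_left sum_subtractf[symmetric] by (simp add: case_prod_unfold)
    also have "\<dots> \<le> (\<Sum>(t, K)\<in>p. e * (Sup K - Inf K) + (if (t, K) \<in> q then E K else 0))"
      using incr by (intro sum_mono) auto
    also have "\<dots> = e * (\<Sum>(t, K)\<in>p. Sup K - Inf K) + (\<Sum>(t, K)\<in>p. if (t, K) \<in> q then E K else 0)"
      by (simp add: sum_distrib_left sum.distrib case_prod_unfold)
    also have "(\<Sum>(t, K)\<in>p. if (t, K) \<in> q then E K else 0) = (\<Sum>(t, K)\<in>q. E K)"
      using \<open>q \<subseteq> p\<close> \<open>finite p\<close> by (intro sum.mono_neutral_cong_right) auto
    also have "e * (\<Sum>(t, K)\<in>p. Sup K - Inf K) + (\<Sum>(t, K)\<in>q. E K)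
        \<le> e * (b - a) + (e + \<bar>L\<bar> * e)"
      using q_le len by simp
    finally show ?thesis by (simp add: algebra_simps)
  qed
  have "f b - f a - L * (b - a) \<le> 0"
  proof (rule field_le_epsilon)
    fix e :: real assume "e > 0"
    then have "e / (b - a + 1 + \<bar>L\<bar>) > 0" using \<open>a \<le> b\<close> by simp
    from small[OF this] show "f b - f a - L * (b - a) \<le> 0 + e" using \<open>a \<le> b\<close> by simp
  qed
  then show ?thesis by simp
qed

section \<open>Unit directions and symmetrised double sums\<close>

lemma unit_dir_minus: "unit_dir (- x) = - unit_dir x"
  by (simp add: unit_dir_def)

lemma inner_unit_dir: "x \<bullet> unit_dir x = norm (x :: 'a::real_inner)"
  by (simp add: unit_dir_def dot_square_norm power2_eq_square)

lemma unit_dir_diff_commute: "unit_dir (x - y) = - unit_dir (y - x)"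
  using unit_dir_minus[of "y - x"] by simp

text \<open>Swapping the indices of the odd function \<open>unit_dir\<close> turns the sum into its
  own negative.\<close>

lemma sum_unit_dir_eq_0: "(\<Sum>i\<in>I. \<Sum>j\<in>I. unit_dir (x i - x j)) = (0 :: 'a::real_normed_vector)"
proof -
  let ?s = "\<Sum>i\<in>I. \<Sum>j\<in>I. unit_dir (x i - x j)"
  have "?s = (\<Sum>i\<in>I. \<Sum>j\<in>I. unit_dir (x j - x i))" by (rule sum.swap)
  also have "\<dots> = (\<Sum>i\<in>I. \<Sum>j\<in>I. - unit_dir (x i - x j))"
    by (intro sum.cong refl unit_dir_diff_commute)
  also have "\<dots> = - ?s" by (simp add: sum_negf)
  finally have "2 *\<^sub>R ?s = 0" by (simp add: scaleR_2 eq_neg_iff_add_eq_0)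
  then show ?thesis by simp
qed

text \<open>Adding the double sum to its copy with swapped indices cancels \<open>c\<close> and
  leaves \<open>(x i - x j) \<bullet> unit_dir (x i - x j)\<close>, which is the distance.\<close>

lemma sum_inner_unit_dir:
  fixes x :: "'i \<Rightarrow> 'a::real_inner"
  shows "2 * (\<Sum>i\<in>I. (x i - c) \<bullet> (\<Sum>j\<in>I. unit_dir (x i - x j))) = (\<Sum>i\<in>I. \<Sum>j\<in>I. norm (x i - x j))"
proof -
  let ?s = "\<Sum>i\<in>I. \<Sum>j\<in>I. (x i - c) \<bullet> unit_dir (x i - x j)"
  have "?s = (\<Sum>i\<in>I. \<Sum>j\<in>I. (x j - c) \<bullet> unit_dir (x j - x i))" by (rule sum.swap)
  also have "\<dots> = (\<Sum>i\<in>I. \<Sum>j\<in>I. - ((x j - c) \<bullet> unit_dir (x i - x j)))"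
    by (intro sum.cong refl) (subst unit_dir_diff_commute, simp)
  finally have "2 * ?s = ?s + (\<Sum>i\<in>I. \<Sum>j\<in>I. - ((x j - c) \<bullet> unit_dir (x i - x j)))" by simp
  also have "\<dots> = (\<Sum>i\<in>I. \<Sum>j\<in>I. (x i - x j) \<bullet> unit_dir (x i - x j))"
    by (simp add: sum.distrib[symmetric] inner_diff_left)
  finally show ?thesis by (simp add: inner_sum_right inner_unit_dir)
qed

text \<open>With \<open>c\<close> the centroid, \<open>\<Sum>j\<in>I. x i - x j\<close> equals
  \<open>card I *\<^sub>R (x i - c)\<close>. The triangle inequality then gives a bound by the sum
  of the displacement norms, which dominates their Euclidean norm.\<close>

lemma sum_norm_diff_ge_L2_set:
  fixes x :: "'i \<Rightarrow> 'a::real_normed_vector"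
  assumes "(\<Sum>i\<in>I. x i) = card I *\<^sub>R c"
  shows "(\<Sum>i\<in>I. \<Sum>j\<in>I. norm (x i - x j)) \<ge> card I * L2_set (\<lambda>i. norm (x i - c)) I"
proof -
  have "card I * L2_set (\<lambda>i. norm (x i - c)) I \<le> card I * (\<Sum>i\<in>I. norm (x i - c))"
    by (intro mult_left_mono L2_set_le_sum) auto
  also have "\<dots> = (\<Sum>i\<in>I. norm (\<Sum>j\<in>I. x i - x j))"
  proof -
    have "(\<Sum>j\<in>I. x i - x j) = card I *\<^sub>R (x i - c)" for i
      by (simp add: sum_subtractf assms sum_constant_scaleR scaleR_diff_right)
    then show ?thesis by (simp add: sum_distrib_left)
  qed
  also have "\<dots> \<le> (\<Sum>i\<in>I. \<Sum>j\<in>I. norm (x i - x j))"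
    by (intro sum_mono norm_sum)
  finally show ?thesis .
qed

section \<open>The norm of the stacked displacements, and reaching zero in finite time\<close>

text \<open>Reverse triangle inequality for the stacked vector. It supplies the domination through
  which the stacked norm inherits absolute continuity from the trajectories.\<close>

lemma L2_set_norm_diff_le:
  fixes x y :: "'i \<Rightarrow> 'a::real_normed_vector"
  shows "\<bar>L2_set (\<lambda>i. norm (x i - c)) I - L2_set (\<lambda>i. norm (y i - c)) I\<bar> \<le> (\<Sum>i\<in>I. norm (x i - y i))"
proof -
  have *: "L2_set (\<lambda>i. norm (x i - c)) I - L2_set (\<lambda>i. norm (y i - c)) I \<le> (\<Sum>i\<in>I. norm (x i - y i))"
    for x y :: "'i \<Rightarrow> 'a"
  proof -
    have "L2_set (\<lambda>i. norm (x i - c)) I \<le> L2_set (\<lambda>i. norm (x i - y i) + norm (y i - c)) I"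
    proof (rule L2_set_mono)
      fix i show "norm (x i - c) \<le> norm (x i - y i) + norm (y i - c)"
        using norm_triangle_ineq[of "x i - y i" "y i - c"] by simp
    qed simp
    also have "\<dots> \<le> L2_set (\<lambda>i. norm (x i - y i)) I + L2_set (\<lambda>i. norm (y i - c)) I"
      by (rule L2_set_triangle_ineq)
    also have "L2_set (\<lambda>i. norm (x i - y i)) I \<le> (\<Sum>i\<in>I. norm (x i - y i))"
      by (rule L2_set_le_sum) simp
    finally show ?thesis by simp
  qed
  show ?thesis using *[of x y] *[of y x] by (simp add: abs_le_iff norm_minus_commute)
qed

text \<open>Chain rule for the square root of the sum of squares; positivity keeps away from 0,
  where the square root is not differentiable.\<close>

lemma has_real_derivative_L2_set_norm:
  fixes p :: "'i \<Rightarrow> real \<Rightarrow> 'a::real_inner"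
  assumes der: "\<And>i. i \<in> I \<Longrightarrow> (p i has_vector_derivative v i) (at t within S)"
    and pos: "L2_set (\<lambda>i. norm (p i t - c)) I > 0"
  shows "((\<lambda>t. L2_set (\<lambda>i. norm (p i t - c)) I) has_real_derivative
      (\<Sum>i\<in>I. (p i t - c) \<bullet> v i) / L2_set (\<lambda>i. norm (p i t - c)) I) (at t within S)"
proof -
  let ?V = "\<lambda>t. \<Sum>i\<in>I. (p i t - c) \<bullet> (p i t - c)"
  have eq: "L2_set (\<lambda>i. norm (p i t - c)) I = sqrt (?V t)" for t
    unfolding L2_set_def dot_square_norm ..
  have "((\<lambda>t. (p i t - c) \<bullet> (p i t - c)) has_real_derivative 2 * ((p i t - c) \<bullet> v i)) (at t within S)"
    if "i \<in> I" for i
  proof -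
    have "((\<lambda>t. p i t - c) has_vector_derivative v i) (at t within S)"
      using has_vector_derivative_diff[OF der[OF that] has_vector_derivative_const] by simp
    from bounded_bilinear.has_vector_derivative[OF bounded_bilinear_inner this this]
    show ?thesis
      unfolding has_real_derivative_iff_has_vector_derivative inner_commute[of "v i"] mult_2 .
  qed
  then have der_V: "(?V has_real_derivative (\<Sum>i\<in>I. 2 * ((p i t - c) \<bullet> v i))) (at t within S)"
    by (rule DERIV_sum)
  have "?V t > 0" using pos unfolding eq by simp
  from DERIV_chain2[OF DERIV_real_sqrt[OF this] der_V] show ?thesis
    unfolding eq by (rule DERIV_cong) (simp add: sum_distrib_left[symmetric] inverse_eq_divide)
qed

text \<open>The derivative bound is only needed where \<open>W > 0\<close>: integrate it from the last zero of \<open>W\<close>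
  before \<open>b\<close>, or from \<open>0\<close> if there is none.\<close>
lemma abs_continuous_on_decreasing_reaches_0:
  fixes W :: "real \<Rightarrow> real"
  assumes "k > 0" "b \<ge> W 0 / k" "b \<ge> 0" and nonneg: "\<And>t. W t \<ge> 0"
    and ac: "abs_continuous_on {0..b} W" and N: "negligible N"
    and der: "\<And>t. \<lbrakk>t \<in> {0..b} - N; W t > 0\<rbrakk>
      \<Longrightarrow> \<exists>D\<le>-k. (W has_real_derivative D) (at t within {0..b})"
  shows "W b = 0"
proof (rule ccontr)
  assume "W b \<noteq> 0"
  with nonneg have Wb: "W b > 0" by (simp add: less_le)
  define Z where "Z = {t \<in> {0..b}. W t = 0}"
  have "closed Z"
    unfolding Z_def using abs_continuous_on_imp_continuous_on[OF ac] closed_atLeastAtMost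
    by (rule continuous_closed_preimage_constant)
  moreover have "bounded Z"
    by (rule bounded_subset[of "{0..b}"]) (auto simp: Z_def)
  ultimately have "compact Z" by (simp add: compact_eq_bounded_closed)
  obtain s where s: "s \<in> {0..b}" "s = 0 \<or> W s = 0" "\<And>t. t \<in> {s<..b} \<Longrightarrow> W t > 0"
  proof (cases "Z = {}")
    case True
    then have "W t > 0" if "t \<in> {0..b}" for t
      using that nonneg[of t] by (auto simp: Z_def less_le)
    then show ?thesis using that[of 0] \<open>b \<ge> 0\<close> by auto
  next
    case False
    then obtain s where s: "s \<in> Z" "\<And>t. t \<in> Z \<Longrightarrow> t \<le> s"
      using compact_attains_sup[OF \<open>compact Z\<close>] by blast
    have "W t > 0" if "t \<in> {s<..b}" for t
    proof -
      have "t \<notin> Z" using s(2)[of t] that by auto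
      then have "W t \<noteq> 0" using s(1) that by (simp add: Z_def)
      then show ?thesis using nonneg[of t] by simp
    qed
    then show ?thesis using that[of s] s(1) by (auto simp: Z_def)
  qed
  have "W b - W s \<le> - k * (b - s)"
  proof (rule abs_continuous_on_increment_le)
    show "abs_continuous_on {s..b} W" using s(1) by (intro abs_continuous_on_subset[OF ac]) auto
    \<comment> \<open>\<open>W\<close> may vanish at \<open>s\<close>, where \<open>der\<close> then
      says nothing, so \<open>s\<close> joins the exceptional set.\<close>
    show "negligible (insert s N)" using N by simp
    fix t assume "t \<in> {s..b} - insert s N"
    then have "t \<in> {0..b} - N" "W t > 0" using s(1,3) by auto
    from der[OF this] obtain D where "D \<le> -k" "(W has_real_derivative D) (at t within {0..b})"
      by blast
    moreover have "{s..b} \<subseteq> {0..b}" using s(1) by simp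
    ultimately show "\<exists>D\<le>-k. (W has_real_derivative D) (at t within {s..b})"
      using DERIV_subset by blast
  qed (use s(1) in auto)
  \<comment> \<open>This settles the case \<open>s = 0\<close>, where
    \<open>W b \<le> W 0 - k * b\<close>; the next inequality settles \<open>W s = 0\<close>. Either
    way \<open>W b \<le> 0\<close>.\<close>
  moreover have "k * b \<ge> W 0" using assms(1,2) by (simp add: field_simps)
  moreover have "k * (b - s) \<ge> 0" using \<open>k > 0\<close> s(1) by simp
  ultimately show False using s(2) Wb by (auto simp: algebra_simps)
qed

section \<open>Properties of trajectories\<close>

lemma bearing_only_trajectory_abs_continuous:
  assumes "bearing_only_trajectory \<sigma> n p" "i \<in> {1..n}"
  shows "abs_continuous_on {0..b} (p i)"
proof -
  \<comment> \<open>For negative \<open>b\<close> the interval \<open>{0..b}\<close> is empty, hence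
    still contained in \<open>{0..max 0 b}\<close>.\<close>
  have "abs_continuous_on {0..max 0 b} (p i)"
    using assms unfolding bearing_only_trajectory_def by simp
  then show ?thesis by (rule abs_continuous_on_subset) simp
qed

text \<open>The exceptional null sets of finitely many agents merge into one, stated as a negligible
  set to fit the increment bound.\<close>

lemma bearing_only_trajectory_derivative:
  assumes "bearing_only_trajectory \<sigma> n p"
  obtains N where "negligible N"
    "\<And>i t. \<lbrakk>i \<in> {1..n}; t \<ge> 0; t \<notin> N\<rbrakk> \<Longrightarrow> (p i has_vector_derivative
       (- \<sigma> *\<^sub>R (\<Sum>j=1..n. unit_dir (p i t - p j t)))) (at t within {0..})"
proof -
  have "AE t in lborel. \<forall>i\<in>{1..n}. t \<ge> 0 \<longrightarrow> (p i has_vector_derivative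
       (- \<sigma> *\<^sub>R (\<Sum>j=1..n. unit_dir (p i t - p j t)))) (at t within {0..})"
    using assms unfolding bearing_only_trajectory_def by (intro AE_finite_allI) auto
  then obtain N where N: "N \<in> null_sets lborel" "\<And>t. t \<notin> N \<Longrightarrow> \<forall>i\<in>{1..n}. t \<ge> 0 \<longrightarrow>
      (p i has_vector_derivative (- \<sigma> *\<^sub>R (\<Sum>j=1..n. unit_dir (p i t - p j t)))) (at t within {0..})"
    by (elim AE_E3) auto
  then have "negligible N" by (simp add: negligible_iff_null_sets null_sets_completionI)
  with N(2) show thesis using that by blast
qed

text \<open>The velocities sum to 0 at almost every time. Since the increment bound is real-valued
  and one-sided, it is applied to the component along \<open>u\<close>, the total change itself;
  this yields \<open>u \<bullet> u \<le> 0\<close>.\<close>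

lemma bearing_only_trajectory_sum_constant:
  fixes p :: "nat \<Rightarrow> real \<Rightarrow> 'a::real_inner"
  assumes p: "bearing_only_trajectory \<sigma> n p" and "b \<ge> 0"
  shows "(\<Sum>i=1..n. p i b) = (\<Sum>i=1..n. p i 0)"
proof -
  obtain N where N: "negligible N"
    "\<And>i t. \<lbrakk>i \<in> {1..n}; t \<ge> 0; t \<notin> N\<rbrakk> \<Longrightarrow> (p i has_vector_derivative
       (- \<sigma> *\<^sub>R (\<Sum>j=1..n. unit_dir (p i t - p j t)))) (at t within {0..})"
    using bearing_only_trajectory_derivative[OF p] by blast
  let ?S = "\<lambda>t. \<Sum>i=1..n. p i t"
  define u where "u = ?S b - ?S 0"
  have "u \<bullet> ?S b - u \<bullet> ?S 0 \<le> 0 * (b - 0)"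
  proof (rule abs_continuous_on_increment_le[OF \<open>b \<ge> 0\<close> _ N(1)])
    show "abs_continuous_on {0..b} (\<lambda>t. u \<bullet> ?S t)"
    proof (rule abs_continuous_on_dominated[of "{1..n}" _ p _ "norm u"])
      fix s t
      have "norm (u \<bullet> ?S t - u \<bullet> ?S s) = \<bar>u \<bullet> (\<Sum>i=1..n. p i t - p i s)\<bar>"
        by (simp add: inner_diff_right sum_subtractf)
      also have "\<dots> \<le> norm u * norm (\<Sum>i=1..n. p i t - p i s)"
        by (rule Cauchy_Schwarz_ineq2)
      also have "\<dots> \<le> norm u * (\<Sum>i=1..n. norm (p i t - p i s))"
        by (intro mult_left_mono norm_sum) simp
      finally show "norm (u \<bullet> ?S t - u \<bullet> ?S s) \<le> \<dots>" .
    qed (use p in \<open>auto intro: bearing_only_trajectory_abs_continuous\<close>)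
    fix t assume t: "t \<in> {0..b} - N"
    have "(?S has_vector_derivative (\<Sum>i=1..n. - \<sigma> *\<^sub>R (\<Sum>j=1..n. unit_dir (p i t - p j t)))) (at t within {0..b})"
      using t by (intro has_vector_derivative_sum has_vector_derivative_within_subset[OF N(2)]) auto
    also have "(\<Sum>i=1..n. - \<sigma> *\<^sub>R (\<Sum>j=1..n. unit_dir (p i t - p j t))) = 0"
      using sum_unit_dir_eq_0[of "\<lambda>i. p i t" "{1..n}"] by (simp only: scaleR_right.sum[symmetric] scaleR_zero_right)
    finally have "((\<lambda>t. u \<bullet> ?S t) has_vector_derivative u \<bullet> 0) (at t within {0..b})"
      by (rule bounded_linear.has_vector_derivative[OF bounded_linear_inner_right])
    then show "\<exists>D\<le>0. ((\<lambda>t. u \<bullet> ?S t) has_real_derivative D) (at t within {0..b})"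
      by (auto simp: has_real_derivative_iff_has_vector_derivative)
  qed
  then have "u \<bullet> u \<le> 0" by (simp add: u_def inner_diff_right)
  then have "u \<bullet> u = 0" by (intro antisym inner_ge_zero)
  then have "u = 0" by (simp only: inner_eq_zero_iff)
  then show ?thesis by (simp add: u_def)
qed

theorem theorem3:
  fixes p :: "nat \<Rightarrow> real \<Rightarrow> real ^ 'd"
    and n :: nat and \<sigma> :: real
  assumes "n \<ge> 1" and "\<sigma> > 0"
    and "bearing_only_trajectory \<sigma> n p"
  shows "\<exists>T\<ge>0. \<forall>i\<in>{1..n}. \<forall>t\<ge>T. p i t = (1 / real n) *\<^sub>R (\<Sum>j=1..n. p j 0)"
proof -
  note p = \<open>bearing_only_trajectory \<sigma> n p\<close>
  obtain N where N: "negligible N"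
    "\<And>i t. \<lbrakk>i \<in> {1..n}; t \<ge> 0; t \<notin> N\<rbrakk> \<Longrightarrow> (p i has_vector_derivative
       (- \<sigma> *\<^sub>R (\<Sum>j=1..n. unit_dir (p i t - p j t)))) (at t within {0..})"
    using bearing_only_trajectory_derivative[OF p] by blast
  define c where "c = (1 / real n) *\<^sub>R (\<Sum>j=1..n. p j 0)"
  define W where "W t = L2_set (\<lambda>i. norm (p i t - c)) {1..n}" for t
  \<comment> \<open>The factor 1/2 comes from symmetrising: the double sum of distances is twice the
    sum of inner products in the derivative of \<open>W\<close>.\<close>
  define k where "k = \<sigma> * n / 2"
  have "k > 0" using assms by (simp add: k_def)
  have W_nonneg: "W t \<ge> 0" for t by (simp add: W_def)
  have "W b = 0" if b: "b \<ge> W 0 / k" for b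
  proof (rule abs_continuous_on_decreasing_reaches_0[where N = N and W = W, OF \<open>k > 0\<close> b])
    have "W 0 / k \<ge> 0" using W_nonneg \<open>k > 0\<close> by simp
    with b show "b \<ge> 0" by linarith
    show "W t \<ge> 0" for t by (rule W_nonneg)
    show "negligible N" by (rule N(1))
    show "abs_continuous_on {0..b} W"
    proof (rule abs_continuous_on_dominated[of "{1..n}" _ p _ 1])
      fix s t show "norm (W t - W s) \<le> 1 * (\<Sum>i=1..n. norm (p i t - p i s))"
        using L2_set_norm_diff_le[of "\<lambda>i. p i t"] by (simp add: W_def)
    qed (use p in \<open>auto intro: bearing_only_trajectory_abs_continuous\<close>)
    fix t assume t: "t \<in> {0..b} - N" and "W t > 0"
    let ?w = "\<lambda>i. \<Sum>j=1..n. unit_dir (p i t - p j t)"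
    have "(W has_real_derivative (\<Sum>i=1..n. (p i t - c) \<bullet> (- \<sigma> *\<^sub>R ?w i)) / W t) (at t within {0..b})"
      using t \<open>W t > 0\<close> unfolding W_def
      by (intro has_real_derivative_L2_set_norm has_vector_derivative_within_subset[OF N(2)]) auto
    moreover have "(\<Sum>i=1..n. (p i t - c) \<bullet> (- \<sigma> *\<^sub>R ?w i)) / W t \<le> - k"
    proof -
      \<comment> \<open>Conservation of the sum makes \<open>c\<close> the centroid at time
        \<open>t\<close> too, as the lower bound on the pairwise distances requires.\<close>
      have "(\<Sum>i=1..n. p i t) = n *\<^sub>R c"
        using bearing_only_trajectory_sum_constant[OF p, of t] t \<open>n \<ge> 1\<close> by (simp add: c_def)
      then have "n * W t \<le> 2 * (\<Sum>i=1..n. (p i t - c) \<bullet> ?w i)"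
        using sum_norm_diff_ge_L2_set[of "\<lambda>i. p i t" "{1..n}" c]
        by (simp add: W_def sum_inner_unit_dir)
      then have "\<sigma> * (n * W t) \<le> \<sigma> * (2 * (\<Sum>i=1..n. (p i t - c) \<bullet> ?w i))"
        using \<open>\<sigma> > 0\<close> by (intro mult_left_mono) auto
      then have "- \<sigma> * (\<Sum>i=1..n. (p i t - c) \<bullet> ?w i) \<le> - k * W t"
        by (simp add: k_def mult.assoc)
      then show ?thesis
        unfolding inner_scaleR_right sum_distrib_left[symmetric] pos_divide_le_eq[OF \<open>W t > 0\<close>] .
    qed
    ultimately show "\<exists>D\<le>-k. (W has_real_derivative D) (at t within {0..b})" by blast
  qed
  then have "p i t = c" if "i \<in> {1..n}" "t \<ge> W 0 / k" for i t
  proof -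
    have "norm (p i t - c) \<le> W t"
      unfolding W_def using that(1) by (intro member_le_L2_set) auto
    also have "W t = 0" using \<open>\<And>b. b \<ge> W 0 / k \<Longrightarrow> W b = 0\<close> that(2) .
    finally show ?thesis by simp
  qed
  moreover have "W 0 / k \<ge> 0" using W_nonneg \<open>k > 0\<close> by simp
  ultimately show ?thesis unfolding c_def by blast
qed

end
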